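(* Let $\Gamma\cup\{\varphi\}$ be a set of formulas over the signature $\Sigma=\{\land,\lor,\to,\neg,\sim,\square\}$. If $\Gamma\vdash_{IvFDE_T}\varphi$, then $\Gamma\models_{IvFDE_T}\varphi$.
   Context: Formulas are built from a countable set of propositional variables using binary $\land,\lor,\to$ and unary $\neg$ (the paradefinite negation), $\sim$ (classical negation) and $\square$. Write $\alpha\leftrightarrow\beta$ for $(\alpha\to\beta)\land(\beta\to\alpha)$. Semantics. On $\{0,1\}$ let $\sqcap,\sqcup,\Rightarrow,\sim$ be the Boolean meet, join, implication and complement, with $0\le 1$. Let $B_T=\{z\in\{0,1\}^4: z_2\le z_1,\ z_1\sqcap z_3=0,\ z_2\sqcap z_4=0,\ z_3\le z_4\}$, whose six elements are $(1,1,0,0),(1,0,0,0),(1,0,0,1),(0,0,0,0),(0,0,0,1),(0,0,1,1)$. The designated set is $D=\{z\in B_T: z_1=1\}$. Each connective is interpreted by a multioperation returning a nonempty subset of $B_T$: - $z\tilde\land w=\{u\in B_T: u_1=z_1\sqcap w_1,\ u_2=z_2\sqcap w_2,\ u_4=z_4\sqcup w_4,\ z_3\sqcup w_3\le u_3\le (z_2\Rightarrow w_3)\sqcap(w_2\Rightarrow z_3)\}$; - $z\tilde\lor w=\{u\in B_T: u_1=z_1\sqcup w_1,\ u_3=z_3\sqcap w_3,\ u_4=z_4\sqcap w_4,\ z_2\sqcup w_2\le u_2\le (z_3\Rightarrow w_2)\sqcap(w_3\Rightarrow z_2)\}$; - $z\tilde\to w=\{u\in B_T: u_1=z_1\Rightarrow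 w_1,\ u_3=z_2\sqcap w_3,\ u_4=z_1\sqcap w_4,\ z_3\sqcup w_2\le u_2\le(z_2\Rightarrow w_2)\sqcap(w_3\Rightarrow z_3)\}$; - $\tilde\sim z=\{u\in B_T: u_1=\sim z_1,\ u_2=z_3,\ u_3=z_2,\ z_2\le u_4\le \sim z_3\}$; - $\tilde\neg z=\{(z_4,z_3,z_2,z_1)\}$; - $\tilde\square z=\{u\in B_T: u_1=z_2\}$. This is the non-deterministic matrix $\mathcal M_{IvFDE_T}$. A valuation is a map $v$ from formulas to $B_T$ with $v(\#(\varphi_1,\dots,\varphi_n))\in\tilde\#(v(\varphi_1),\dots,v(\varphi_n))$ for every connective $\#$. We write $\Gamma\models_{IvFDE_T}\varphi$ iff every valuation $v$ with $v(\gamma)\in D$ for all $\gamma\in\Gamma$ also has $v(\varphi)\in D$. Hilbert calculus $IvFDE_T$. The only rule is modus ponens: from $\varphi$ and $\varphi\to\psi$ infer $\psi$. The axiom schemas are: - (Ax1) $\varphi\to(\psi\to\varphi)$; - (Ax2) $(\varphi\to(\psi\to\gamma))\to((\varphi\to\psi)\to(\varphi\to\gamma))$; - (Ax3) $\varphi\to(\psi\to(\varphi\land\psi))$; - (Ax4) $(\varphi\land\psi)\to\varphi$; - (Ax5) $(\varphi\land\psi)\to\psi$; - (Ax6) $\varphi\to(\varphi\lor\psi)$; - (Ax7) $\psi\to(\varphi\lor\psi)$; - (Ax8) $(\varphi\to\gamma)\to((\psi\to\gamma)\to((\varphi\lor\psi)\to\gamma))$; - (DN) $\neg\neg\varphi\leftrightarrow\varphi$;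 - (DM1) $\neg(\varphi\lor\psi)\leftrightarrow(\neg\varphi\land\neg\psi)$; - (DM2) $\neg(\varphi\land\psi)\leftrightarrow(\neg\varphi\lor\neg\psi)$; - (DM3) $\neg(\varphi\to\psi)\leftrightarrow(\varphi\land\neg\psi)$; - (AxP) $\varphi\lor(\varphi\to\psi)$; - (Ax9) $(\sim\psi\to\sim\varphi)\to((\sim\psi\to\varphi)\to\psi)$; - (K) $\square(\varphi\to\psi)\to(\square\varphi\to\square\psi)$; - (K1) $\square(\varphi\to\psi)\to(\square\sim\psi\to\square\sim\varphi)$; - (K2) $\square\sim(\varphi\to\psi)\leftrightarrow(\square\varphi\land\square\sim\psi)$; - (M1) $(\square\sim\varphi\lor\square\psi)\to\square(\varphi\to\psi)$; - (T) $\square\varphi\to\varphi$; - (DN1) $\square\varphi\leftrightarrow\square\sim\sim\varphi$; - (N1) $\square(\varphi\land\psi)\leftrightarrow(\square\varphi\land\square\psi)$; - (N2) $\square\sim(\varphi\lor\psi)\leftrightarrow\square(\sim\varphi\land\sim\psi)$; - (N3) $(\square\sim\varphi\lor\square\sim\psi)\to\square\sim(\varphi\land\psi)$; - (N4) $(\square\varphi\lor\square\psi)\to\square(\varphi\lor\psi)$; - (N5) $\square\varphi\leftrightarrow\square\sim\neg\varphi$; - (N6) $\square\sim\varphi\leftrightarrow\square\sim\neg\neg\varphi$; - (N7) $\square\sim(\varphi\land\psi)\to(\square\varphi\to\square\sim\psi)$; - (N8) $\square\sim(\varphi\land\psi)\to(\square\psi\to\square\sim\varphi)$; - (N9) $\square(\varphi\lor\psi)\to(\square\sim\varphi\to\square\psi)$;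 - (N10) $\square(\varphi\lor\psi)\to(\square\sim\psi\to\square\varphi)$. $\Gamma\vdash_{IvFDE_T}\varphi$ means $\varphi$ is derivable from $\Gamma$ in this calculus. *)

theory Defs
  imports "HOL-Library.Countable"
begin

datatype 'p fm =
    Var 'p
  | And "'p fm" "'p fm"  (infixr "\<^bold>\<and>" 75)
  | Or "'p fm" "'p fm"  (infixr "\<^bold>\<or>" 70)
  | Imp "'p fm" "'p fm"  (infixr "\<^bold>\<rightarrow>" 65)
  | Neg "'p fm"  ("\<^bold>\<not> _" [80] 80)  \<comment> \<open>paradefinite negation\<close>
  | CNeg "'p fm"  ("\<^bold>\<sim> _" [80] 80)  \<comment> \<open>classical negation\<close>
  | Box "'p fm"  ("\<^bold>\<box> _" [80] 80)

abbreviation Iff :: "'p fm \<Rightarrow> 'p fm \<Rightarrow> 'p fm"  (infix "\<^bold>\<leftrightarrow>" 60) where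
  "\<alpha> \<^bold>\<leftrightarrow> \<beta> \<equiv> (\<alpha> \<^bold>\<rightarrow> \<beta>) \<^bold>\<and> (\<beta> \<^bold>\<rightarrow> \<alpha>)"

text \<open>The two-element Boolean algebra is type \<^typ>\<open>bool\<close>, so that \<open>\<le>\<close> between truth values is
  its Boolean order; quadruples are nested pairs.\<close>

type_synonym val = "bool \<times> bool \<times> bool \<times> bool"

definition B_T :: "val set" where
  "B_T = {(z1, z2, z3, z4). z2 \<le> z1 \<and> (z1 \<and> z3) = False \<and> (z2 \<and> z4) = False \<and> z3 \<le> z4}"

definition D :: "val set" where
  "D = {(z1, z2, z3, z4) \<in> B_T. z1 = True}"

fun and_T :: "val \<Rightarrow> val \<Rightarrow> val set" where
  "and_T (z1, z2, z3, z4) (w1, w2, w3, w4) =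
    {(u1, u2, u3, u4) \<in> B_T.
      u1 = (z1 \<and> w1) \<and> u2 = (z2 \<and> w2) \<and> u4 = (z4 \<or> w4) \<and>
      (z3 \<or> w3) \<le> u3 \<and> u3 \<le> ((z2 \<longrightarrow> w3) \<and> (w2 \<longrightarrow> z3))}"

fun or_T :: "val \<Rightarrow> val \<Rightarrow> val set" where
  "or_T (z1, z2, z3, z4) (w1, w2, w3, w4) =
    {(u1, u2, u3, u4) \<in> B_T.
      u1 = (z1 \<or> w1) \<and> u3 = (z3 \<and> w3) \<and> u4 = (z4 \<and> w4) \<and>
      (z2 \<or> w2) \<le> u2 \<and> u2 \<le> ((z3 \<longrightarrow> w2) \<and> (w3 \<longrightarrow> z2))}"

fun imp_T :: "val \<Rightarrow> val \<Rightarrow> val set" where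
  "imp_T (z1, z2, z3, z4) (w1, w2, w3, w4) =
    {(u1, u2, u3, u4) \<in> B_T.
      u1 = (z1 \<longrightarrow> w1) \<and> u3 = (z2 \<and> w3) \<and> u4 = (z1 \<and> w4) \<and>
      (z3 \<or> w2) \<le> u2 \<and> u2 \<le> ((z2 \<longrightarrow> w2) \<and> (w3 \<longrightarrow> z3))}"

fun cneg_T :: "val \<Rightarrow> val set" where
  "cneg_T (z1, z2, z3, z4) =
    {(u1, u2, u3, u4) \<in> B_T. u1 = (\<not> z1) \<and> u2 = z3 \<and> u3 = z2 \<and> z2 \<le> u4 \<and> u4 \<le> (\<not> z3)}"

fun neg_T :: "val \<Rightarrow> val set" where
  "neg_T (z1, z2, z3, z4) = {(z4, z3, z2, z1)}"

fun box_T :: "val \<Rightarrow> val set" where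
  "box_T (z1, z2, z3, z4) = {(u1, u2, u3, u4) \<in> B_T. u1 = z2}"

lemma B_T_eq:
  "B_T = {(True, True, False, False), (True, False, False, False), (True, False, False, True),
          (False, False, False, False), (False, False, False, True), (False, False, True, True)}"
  unfolding B_T_def le_bool_def by (simp add: set_eq_iff split_paired_All all_bool_eq)

lemma multioperations_nonempty:
  assumes "z \<in> B_T" "w \<in> B_T"
  shows "and_T z w \<noteq> {}" "or_T z w \<noteq> {}" "imp_T z w \<noteq> {}"
    "cneg_T z \<noteq> {}" "neg_T z \<noteq> {}" "box_T z \<noteq> {}"
proof -
  obtain z1 z2 z3 z4 where z: "z = (z1, z2, z3, z4)" by (rule prod_cases4)
  obtain w1 w2 w3 w4 where w: "w = (w1, w2, w3, w4)" by (rule prod_cases4)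
  have B: "z2 \<longrightarrow> z1" "\<not> (z1 \<and> z3)" "\<not> (z2 \<and> z4)" "z3 \<longrightarrow> z4"
    "w2 \<longrightarrow> w1" "\<not> (w1 \<and> w3)" "\<not> (w2 \<and> w4)" "w3 \<longrightarrow> w4"
    using assms by (simp_all add: z w B_T_def le_bool_def)
  have "(z1 \<and> w1, z2 \<and> w2, z3 \<or> w3, z4 \<or> w4) \<in> and_T z w"
    unfolding z w and_T.simps B_T_def le_bool_def mem_Collect_eq prod.case using B by argo
  then show "and_T z w \<noteq> {}" by blast
  have "(z1 \<or> w1, z2 \<or> w2, z3 \<and> w3, z4 \<and> w4) \<in> or_T z w"
    unfolding z w or_T.simps B_T_def le_bool_def mem_Collect_eq prod.case using B by argo
  then show "or_T z w \<noteq> {}" by blast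
  have "(z1 \<longrightarrow> w1, z3 \<or> w2, z2 \<and> w3, z1 \<and> w4) \<in> imp_T z w"
    unfolding z w imp_T.simps B_T_def le_bool_def mem_Collect_eq prod.case using B by argo
  then show "imp_T z w \<noteq> {}" by blast
  have "(\<not> z1, z3, z2, z2) \<in> cneg_T z"
    unfolding z cneg_T.simps B_T_def le_bool_def mem_Collect_eq prod.case using B by argo
  then show "cneg_T z \<noteq> {}" by blast
  show "neg_T z \<noteq> {}" by (simp add: z)
  have "(z2, False, False, False) \<in> box_T z"
    unfolding z box_T.simps B_T_def le_bool_def mem_Collect_eq prod.case using B by argo
  then show "box_T z \<noteq> {}" by blast
qed

definition valuation :: "('p fm \<Rightarrow> val) \<Rightarrow> bool" where
  "valuation v \<longleftrightarrow>
    (\<forall>\<phi>. v \<phi> \<in> B_T) \<and>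
    (\<forall>\<phi> \<psi>. v (\<phi> \<^bold>\<and> \<psi>) \<in> and_T (v \<phi>) (v \<psi>)) \<and>
    (\<forall>\<phi> \<psi>. v (\<phi> \<^bold>\<or> \<psi>) \<in> or_T (v \<phi>) (v \<psi>)) \<and>
    (\<forall>\<phi> \<psi>. v (\<phi> \<^bold>\<rightarrow> \<psi>) \<in> imp_T (v \<phi>) (v \<psi>)) \<and>
    (\<forall>\<phi>. v (\<^bold>\<not> \<phi>) \<in> neg_T (v \<phi>)) \<and>
    (\<forall>\<phi>. v (\<^bold>\<sim> \<phi>) \<in> cneg_T (v \<phi>)) \<and>
    (\<forall>\<phi>. v (\<^bold>\<box> \<phi>) \<in> box_T (v \<phi>))"

definition entails :: "'p fm set \<Rightarrow> 'p fm \<Rightarrow> bool"  (infix "\<Turnstile>" 50) where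
  "\<Gamma> \<Turnstile> \<phi> \<longleftrightarrow> (\<forall>v. valuation v \<longrightarrow> (\<forall>\<gamma>\<in>\<Gamma>. v \<gamma> \<in> D) \<longrightarrow> v \<phi> \<in> D)"

inductive ax :: "'p fm \<Rightarrow> bool" where
  Ax1: "ax (\<phi> \<^bold>\<rightarrow> (\<psi> \<^bold>\<rightarrow> \<phi>))"
| Ax2: "ax ((\<phi> \<^bold>\<rightarrow> (\<psi> \<^bold>\<rightarrow> \<gamma>)) \<^bold>\<rightarrow> ((\<phi> \<^bold>\<rightarrow> \<psi>) \<^bold>\<rightarrow> (\<phi> \<^bold>\<rightarrow> \<gamma>)))"
| Ax3: "ax (\<phi> \<^bold>\<rightarrow> (\<psi> \<^bold>\<rightarrow> (\<phi> \<^bold>\<and> \<psi>)))"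
| Ax4: "ax ((\<phi> \<^bold>\<and> \<psi>) \<^bold>\<rightarrow> \<phi>)"
| Ax5: "ax ((\<phi> \<^bold>\<and> \<psi>) \<^bold>\<rightarrow> \<psi>)"
| Ax6: "ax (\<phi> \<^bold>\<rightarrow> (\<phi> \<^bold>\<or> \<psi>))"
| Ax7: "ax (\<psi> \<^bold>\<rightarrow> (\<phi> \<^bold>\<or> \<psi>))"
| Ax8: "ax ((\<phi> \<^bold>\<rightarrow> \<gamma>) \<^bold>\<rightarrow> ((\<psi> \<^bold>\<rightarrow> \<gamma>) \<^bold>\<rightarrow> ((\<phi> \<^bold>\<or> \<psi>) \<^bold>\<rightarrow> \<gamma>)))"
| DN: "ax (\<^bold>\<not> \<^bold>\<not> \<phi> \<^bold>\<leftrightarrow> \<phi>)"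
| DM1: "ax (\<^bold>\<not> (\<phi> \<^bold>\<or> \<psi>) \<^bold>\<leftrightarrow> (\<^bold>\<not> \<phi> \<^bold>\<and> \<^bold>\<not> \<psi>))"
| DM2: "ax (\<^bold>\<not> (\<phi> \<^bold>\<and> \<psi>) \<^bold>\<leftrightarrow> (\<^bold>\<not> \<phi> \<^bold>\<or> \<^bold>\<not> \<psi>))"
| DM3: "ax (\<^bold>\<not> (\<phi> \<^bold>\<rightarrow> \<psi>) \<^bold>\<leftrightarrow> (\<phi> \<^bold>\<and> \<^bold>\<not> \<psi>))"
| AxP: "ax (\<phi> \<^bold>\<or> (\<phi> \<^bold>\<rightarrow> \<psi>))"
| Ax9: "ax ((\<^bold>\<sim> \<psi> \<^bold>\<rightarrow> \<^bold>\<sim> \<phi>) \<^bold>\<rightarrow> ((\<^bold>\<sim> \<psi> \<^bold>\<rightarrow> \<phi>) \<^bold>\<rightarrow> \<psi>))"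
| K: "ax (\<^bold>\<box> (\<phi> \<^bold>\<rightarrow> \<psi>) \<^bold>\<rightarrow> (\<^bold>\<box> \<phi> \<^bold>\<rightarrow> \<^bold>\<box> \<psi>))"
| K1: "ax (\<^bold>\<box> (\<phi> \<^bold>\<rightarrow> \<psi>) \<^bold>\<rightarrow> (\<^bold>\<box> \<^bold>\<sim> \<psi> \<^bold>\<rightarrow> \<^bold>\<box> \<^bold>\<sim> \<phi>))"
| K2: "ax (\<^bold>\<box> \<^bold>\<sim> (\<phi> \<^bold>\<rightarrow> \<psi>) \<^bold>\<leftrightarrow> (\<^bold>\<box> \<phi> \<^bold>\<and> \<^bold>\<box> \<^bold>\<sim> \<psi>))"
| M1: "ax ((\<^bold>\<box> \<^bold>\<sim> \<phi> \<^bold>\<or> \<^bold>\<box> \<psi>) \<^bold>\<rightarrow> \<^bold>\<box> (\<phi> \<^bold>\<rightarrow> \<psi>))"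
| T: "ax (\<^bold>\<box> \<phi> \<^bold>\<rightarrow> \<phi>)"
| DN1: "ax (\<^bold>\<box> \<phi> \<^bold>\<leftrightarrow> \<^bold>\<box> \<^bold>\<sim> \<^bold>\<sim> \<phi>)"
| N1: "ax (\<^bold>\<box> (\<phi> \<^bold>\<and> \<psi>) \<^bold>\<leftrightarrow> (\<^bold>\<box> \<phi> \<^bold>\<and> \<^bold>\<box> \<psi>))"
| N2: "ax (\<^bold>\<box> \<^bold>\<sim> (\<phi> \<^bold>\<or> \<psi>) \<^bold>\<leftrightarrow> \<^bold>\<box> (\<^bold>\<sim> \<phi> \<^bold>\<and> \<^bold>\<sim> \<psi>))"
| N3: "ax ((\<^bold>\<box> \<^bold>\<sim> \<phi> \<^bold>\<or> \<^bold>\<box> \<^bold>\<sim> \<psi>) \<^bold>\<rightarrow> \<^bold>\<box> \<^bold>\<sim> (\<phi> \<^bold>\<and> \<psi>))"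
| N4: "ax ((\<^bold>\<box> \<phi> \<^bold>\<or> \<^bold>\<box> \<psi>) \<^bold>\<rightarrow> \<^bold>\<box> (\<phi> \<^bold>\<or> \<psi>))"
| N5: "ax (\<^bold>\<box> \<phi> \<^bold>\<leftrightarrow> \<^bold>\<box> \<^bold>\<sim> \<^bold>\<not> \<phi>)"
| N6: "ax (\<^bold>\<box> \<^bold>\<sim> \<phi> \<^bold>\<leftrightarrow> \<^bold>\<box> \<^bold>\<sim> \<^bold>\<not> \<^bold>\<not> \<phi>)"
| N7: "ax (\<^bold>\<box> \<^bold>\<sim> (\<phi> \<^bold>\<and> \<psi>) \<^bold>\<rightarrow> (\<^bold>\<box> \<phi> \<^bold>\<rightarrow> \<^bold>\<box> \<^bold>\<sim> \<psi>))"
| N8: "ax (\<^bold>\<box> \<^bold>\<sim> (\<phi> \<^bold>\<and> \<psi>) \<^bold>\<rightarrow> (\<^bold>\<box> \<psi> \<^bold>\<rightarrow> \<^bold>\<box> \<^bold>\<sim> \<phi>))"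
| N9: "ax (\<^bold>\<box> (\<phi> \<^bold>\<or> \<psi>) \<^bold>\<rightarrow> (\<^bold>\<box> \<^bold>\<sim> \<phi> \<^bold>\<rightarrow> \<^bold>\<box> \<psi>))"
| N10: "ax (\<^bold>\<box> (\<phi> \<^bold>\<or> \<psi>) \<^bold>\<rightarrow> (\<^bold>\<box> \<^bold>\<sim> \<psi> \<^bold>\<rightarrow> \<^bold>\<box> \<phi>))"

inductive derives :: "'p fm set \<Rightarrow> 'p fm \<Rightarrow> bool"  (infix "\<turnstile>" 50) for \<Gamma> :: "'p fm set" where
  premise: "\<phi> \<in> \<Gamma> \<Longrightarrow> \<Gamma> \<turnstile> \<phi>"
| axiom_instance: "ax \<phi> \<Longrightarrow> \<Gamma> \<turnstile> \<phi>"
| modus_ponens: "\<Gamma> \<turnstile> \<phi> \<Longrightarrow> \<Gamma> \<turnstile> \<phi> \<^bold>\<rightarrow> \<psi> \<Longrightarrow> \<Gamma> \<turnstile> \<psi>"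

end

theory Submission
  imports Defs
begin

text \<open>Writing \<open>v \<phi> = (c\<^sub>1, c\<^sub>2, c\<^sub>3, c\<^sub>4)\<close>, the coordinates are the truth values of
  \<open>\<phi>\<close>, \<open>\<^bold>\<box> \<phi>\<close>, \<open>\<^bold>\<box> \<^bold>\<sim> \<phi>\<close> and \<open>\<^bold>\<not> \<phi>\<close> respectively. Each multioperation fixes some
  coordinates and bounds others, and under this reading every axiom is a Boolean consequence of
  these equations and bounds.\<close>

fun c1 :: "val \<Rightarrow> bool" where "c1 (z1, z2, z3, z4) = z1"
fun c2 :: "val \<Rightarrow> bool" where "c2 (z1, z2, z3, z4) = z2"
fun c3 :: "val \<Rightarrow> bool" where "c3 (z1, z2, z3, z4) = z3"
fun c4 :: "val \<Rightarrow> bool" where "c4 (z1, z2, z3, z4) = z4"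

lemma D_iff: "z \<in> B_T \<Longrightarrow> z \<in> D \<longleftrightarrow> c1 z"
  by (cases z rule: c1.cases) (simp add: D_def)

text \<open>Clause \<open>z2 \<le> z1\<close> in the definition of \<open>B_T\<close>; under the
  coordinate reading it is axiom (T).\<close>

lemma B_T_c2_imp_c1: "z \<in> B_T \<Longrightarrow> c2 z \<Longrightarrow> c1 z"
  by (cases z rule: c1.cases) (simp add: B_T_def)

text \<open>The defining equations of the multioperations match only explicit quadruples. Restated
  through the projections they apply directly to values such as \<open>v \<phi>\<close>, and turning
  the Boolean order into implication makes the conditions purely propositional.\<close>

lemma mem_and_T_iff: "u \<in> and_T z w \<longleftrightarrow> u \<in> B_T \<and>
    c1 u = (c1 z \<and> c1 w) \<and> c2 u = (c2 z \<and> c2 w) \<and> c4 u = (c4 z \<or> c4 w) \<and>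
    (c3 z \<or> c3 w \<longrightarrow> c3 u) \<and> (c3 u \<longrightarrow> (c2 z \<longrightarrow> c3 w) \<and> (c2 w \<longrightarrow> c3 z))"
  by (cases u rule: c1.cases, cases z rule: c1.cases, cases w rule: c1.cases) (simp add: le_bool_def)

lemma mem_or_T_iff: "u \<in> or_T z w \<longleftrightarrow> u \<in> B_T \<and>
    c1 u = (c1 z \<or> c1 w) \<and> c3 u = (c3 z \<and> c3 w) \<and> c4 u = (c4 z \<and> c4 w) \<and>
    (c2 z \<or> c2 w \<longrightarrow> c2 u) \<and> (c2 u \<longrightarrow> (c3 z \<longrightarrow> c2 w) \<and> (c3 w \<longrightarrow> c2 z))"
  by (cases u rule: c1.cases, cases z rule: c1.cases, cases w rule: c1.cases) (simp add: le_bool_def)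

lemma mem_imp_T_iff: "u \<in> imp_T z w \<longleftrightarrow> u \<in> B_T \<and>
    c1 u = (c1 z \<longrightarrow> c1 w) \<and> c3 u = (c2 z \<and> c3 w) \<and> c4 u = (c1 z \<and> c4 w) \<and>
    (c3 z \<or> c2 w \<longrightarrow> c2 u) \<and> (c2 u \<longrightarrow> (c2 z \<longrightarrow> c2 w) \<and> (c3 w \<longrightarrow> c3 z))"
  by (cases u rule: c1.cases, cases z rule: c1.cases, cases w rule: c1.cases) (simp add: le_bool_def)

lemma mem_cneg_T_iff: "u \<in> cneg_T z \<longleftrightarrow> u \<in> B_T \<and>
    c1 u = (\<not> c1 z) \<and> c2 u = c3 z \<and> c3 u = c2 z \<and> (c2 z \<longrightarrow> c4 u) \<and> (c4 u \<longrightarrow> \<not> c3 z)"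
  by (cases u rule: c1.cases, cases z rule: c1.cases) (simp add: le_bool_def)

lemma mem_neg_T_iff: "u \<in> neg_T z \<longleftrightarrow>
    c1 u = c4 z \<and> c2 u = c3 z \<and> c3 u = c2 z \<and> c4 u = c1 z"
  by (cases u rule: c1.cases, cases z rule: c1.cases) simp

lemma mem_box_T_iff: "u \<in> box_T z \<longleftrightarrow> u \<in> B_T \<and> c1 u = c2 z"
  by (cases u rule: c1.cases, cases z rule: c1.cases) simp

lemma valuation_designated_iff: "valuation v \<Longrightarrow> v \<phi> \<in> D \<longleftrightarrow> c1 (v \<phi>)"
  by (simp add: valuation_def D_iff)

text \<open>Instantiated at one pair of formulas, this collects all constraints as a quantifier-free
  fact, suitable for propositional reasoning by \<open>argo\<close>.\<close>

lemma valuation_mem: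
  assumes "valuation v"
  shows "v \<phi> \<in> B_T \<and> v (\<phi> \<^bold>\<and> \<psi>) \<in> and_T (v \<phi>) (v \<psi>) \<and>
    v (\<phi> \<^bold>\<or> \<psi>) \<in> or_T (v \<phi>) (v \<psi>) \<and> v (\<phi> \<^bold>\<rightarrow> \<psi>) \<in> imp_T (v \<phi>) (v \<psi>) \<and>
    v (\<^bold>\<sim> \<phi>) \<in> cneg_T (v \<phi>) \<and> v (\<^bold>\<not> \<phi>) \<in> neg_T (v \<phi>) \<and> v (\<^bold>\<box> \<phi>) \<in> box_T (v \<phi>)"
  using assms by (simp add: valuation_def)

text \<open>These are the coordinates that the multioperations determine. As rewrite rules they push
  the projections down to subformulas; the free coordinates, such as \<open>c3\<close> of a
  conjunction or \<open>c2\<close> of a disjunction or implication, stay as atoms.\<close>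

lemma valuation_coords:
  assumes "valuation v"
  shows "c1 (v (\<phi> \<^bold>\<and> \<psi>)) \<longleftrightarrow> c1 (v \<phi>) \<and> c1 (v \<psi>)"
    "c2 (v (\<phi> \<^bold>\<and> \<psi>)) \<longleftrightarrow> c2 (v \<phi>) \<and> c2 (v \<psi>)"
    "c4 (v (\<phi> \<^bold>\<and> \<psi>)) \<longleftrightarrow> c4 (v \<phi>) \<or> c4 (v \<psi>)"
    "c1 (v (\<phi> \<^bold>\<or> \<psi>)) \<longleftrightarrow> c1 (v \<phi>) \<or> c1 (v \<psi>)"
    "c3 (v (\<phi> \<^bold>\<or> \<psi>)) \<longleftrightarrow> c3 (v \<phi>) \<and> c3 (v \<psi>)"
    "c4 (v (\<phi> \<^bold>\<or> \<psi>)) \<longleftrightarrow> c4 (v \<phi>) \<and> c4 (v \<psi>)"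
    "c1 (v (\<phi> \<^bold>\<rightarrow> \<psi>)) \<longleftrightarrow> (c1 (v \<phi>) \<longrightarrow> c1 (v \<psi>))"
    "c3 (v (\<phi> \<^bold>\<rightarrow> \<psi>)) \<longleftrightarrow> c2 (v \<phi>) \<and> c3 (v \<psi>)"
    "c4 (v (\<phi> \<^bold>\<rightarrow> \<psi>)) \<longleftrightarrow> c1 (v \<phi>) \<and> c4 (v \<psi>)"
    "c1 (v (\<^bold>\<sim> \<phi>)) \<longleftrightarrow> \<not> c1 (v \<phi>)"
    "c2 (v (\<^bold>\<sim> \<phi>)) \<longleftrightarrow> c3 (v \<phi>)"
    "c3 (v (\<^bold>\<sim> \<phi>)) \<longleftrightarrow> c2 (v \<phi>)"
    "c1 (v (\<^bold>\<not> \<phi>)) \<longleftrightarrow> c4 (v \<phi>)"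
    "c2 (v (\<^bold>\<not> \<phi>)) \<longleftrightarrow> c3 (v \<phi>)"
    "c3 (v (\<^bold>\<not> \<phi>)) \<longleftrightarrow> c2 (v \<phi>)"
    "c4 (v (\<^bold>\<not> \<phi>)) \<longleftrightarrow> c1 (v \<phi>)"
    "c1 (v (\<^bold>\<box> \<phi>)) \<longleftrightarrow> c2 (v \<phi>)"
  using valuation_mem[OF assms, of \<phi> \<psi>]
  unfolding mem_and_T_iff mem_or_T_iff mem_imp_T_iff mem_cneg_T_iff mem_neg_T_iff mem_box_T_iff
  by argo+

text \<open>For the free coordinates \<open>c3\<close> of a conjunction and \<open>c2\<close> of a
  disjunction or implication only bounds are available: the lower ones yield (N3), (N4), (M1), the
  upper ones (N7)-(N10), (K), (K1).\<close>

lemma valuation_bounds: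
  assumes "valuation v"
  shows "c2 (v \<phi>) \<Longrightarrow> c1 (v \<phi>)"
    "c3 (v \<phi>) \<or> c3 (v \<psi>) \<Longrightarrow> c3 (v (\<phi> \<^bold>\<and> \<psi>))"
    "c3 (v (\<phi> \<^bold>\<and> \<psi>)) \<Longrightarrow> (c2 (v \<phi>) \<longrightarrow> c3 (v \<psi>)) \<and> (c2 (v \<psi>) \<longrightarrow> c3 (v \<phi>))"
    "c2 (v \<phi>) \<or> c2 (v \<psi>) \<Longrightarrow> c2 (v (\<phi> \<^bold>\<or> \<psi>))"
    "c2 (v (\<phi> \<^bold>\<or> \<psi>)) \<Longrightarrow> (c3 (v \<phi>) \<longrightarrow> c2 (v \<psi>)) \<and> (c3 (v \<psi>) \<longrightarrow> c2 (v \<phi>))"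
    "c3 (v \<phi>) \<or> c2 (v \<psi>) \<Longrightarrow> c2 (v (\<phi> \<^bold>\<rightarrow> \<psi>))"
    "c2 (v (\<phi> \<^bold>\<rightarrow> \<psi>)) \<Longrightarrow> (c2 (v \<phi>) \<longrightarrow> c2 (v \<psi>)) \<and> (c3 (v \<psi>) \<longrightarrow> c3 (v \<phi>))"
  using valuation_mem[OF assms, of \<phi> \<psi>] B_T_c2_imp_c1[of "v \<phi>"]
  unfolding mem_and_T_iff mem_or_T_iff mem_imp_T_iff
  by argo+

lemma ax_valid:
  assumes "ax \<phi>" and v: "valuation v"
  shows "c1 (v \<phi>)"
  using assms(1)
proof cases
  case (K \<alpha> \<beta>)
  \<comment> \<open>The two conjuncts of the upper bound on \<open>c2\<close> of an implication give
    (K) and (K1) respectively; (N7)/(N8) and (N9)/(N10) split their bounds in the same way.\<close>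
  then show ?thesis using valuation_bounds(7)[OF v, of \<alpha> \<beta>] by (simp add: valuation_coords[OF v])
next
  case (K1 \<alpha> \<beta>)
  then show ?thesis using valuation_bounds(7)[OF v, of \<alpha> \<beta>] by (simp add: valuation_coords[OF v])
next
  case (M1 \<alpha> \<beta>)
  then show ?thesis using valuation_bounds(6)[OF v, of \<alpha> \<beta>] by (simp add: valuation_coords[OF v])
next
  case (T \<alpha>)
  then show ?thesis using valuation_bounds(1)[OF v, of \<alpha>] by (simp add: valuation_coords[OF v])
next
  case (N3 \<alpha> \<beta>)
  then show ?thesis using valuation_bounds(2)[OF v, of \<alpha> \<beta>] by (simp add: valuation_coords[OF v])
next
  case (N4 \<alpha> \<beta>)
  then show ?thesis using valuation_bounds(4)[OF v, of \<alpha> \<beta>] by (simp add: valuation_coords[OF v])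
next
  case (N7 \<alpha> \<beta>)
  then show ?thesis using valuation_bounds(3)[OF v, of \<alpha> \<beta>] by (simp add: valuation_coords[OF v])
next
  case (N8 \<alpha> \<beta>)
  then show ?thesis using valuation_bounds(3)[OF v, of \<alpha> \<beta>] by (simp add: valuation_coords[OF v])
next
  case (N9 \<alpha> \<beta>)
  then show ?thesis using valuation_bounds(5)[OF v, of \<alpha> \<beta>] by (simp add: valuation_coords[OF v])
next
  case (N10 \<alpha> \<beta>)
  then show ?thesis using valuation_bounds(5)[OF v, of \<alpha> \<beta>] by (simp add: valuation_coords[OF v])
\<comment> \<open>The remaining axioms involve determined coordinates only, so rewriting leaves
  propositional tautologies.\<close>
qed (auto simp: valuation_coords[OF v])

theorem mainTheorem1:
  fixes \<Gamma> :: "('p::countable) fm set" and \<phi> :: "'p fm"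
  assumes "\<Gamma> \<turnstile> \<phi>"
  shows "\<Gamma> \<Turnstile> \<phi>"
  unfolding entails_def
proof (intro allI impI)
  fix v :: "'p fm \<Rightarrow> val"
  assume v: "valuation v" and \<Gamma>: "\<forall>\<gamma>\<in>\<Gamma>. v \<gamma> \<in> D"
  \<comment> \<open>The induction runs on the first coordinate, equivalent to designation for a
    valuation, because the rewrite rules act on it.\<close>
  from assms have "c1 (v \<phi>)"
  proof induction
    case (premise \<phi>)
    then show ?case using \<Gamma> valuation_designated_iff[OF v] by blast
  next
    case (axiom_instance \<phi>)
    then show ?case using v by (rule ax_valid)
  next
    case (modus_ponens \<phi> \<psi>)
    \<comment> \<open>Modus ponens preserves truth since \<open>c1\<close> of an implication is
      classical implication of the \<open>c1\<close> values.\<close>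
    then show ?case by (simp add: valuation_coords[OF v])
  qed
  then show "v \<phi> \<in> D" by (simp add: valuation_designated_iff[OF v])
qed

end
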